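(* Let $\Gamma$ be a finite group and let $G$ be a finite undirected multigraph with vertices $v_1,\dots,v_n$, each vertex $v_i$ being decorated with an element $t_i\in\Gamma$, such that $\{t_1,\dots,t_n\}$ generates $\Gamma$. Assume that: (1) the adjacency matrix $A(G)$ is a Perron–Frobenius matrix, i.e. it has a unique eigenvalue of maximal modulus and some power $A(G)^k$ has all entries positive; (2) for every nontrivial one-dimensional unitary representation $\rho$ of $\Gamma$ there exist $1\le i,j\le n$ such that $\rho(t_i)\ne\rho(t_j)$. Let $1\le i,j\le n$. Then the distributions $P_{N,i,j}$ on $\Gamma$ (the distribution of the product of the decorations along a uniformly random walk of length $N$ from $v_i$ to $v_j$) converge to the uniform distribution on $\Gamma$ as $N\to\infty$. Furthermore, there is a constant $c<1$ such that for all $N\ge1$ for which $P_{N,i,j}$ is defined and all $\gamma\in\Gamma$ $$p_{N,i,j}(\gamma)-\frac{1}{|\Gamma|}<c^N .$$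
   Context: A walk $w=(v_{i_1},v_{i_2},\dots,v_{i_k})$ on $G$ is a sequence of vertices with consecutive vertices joined by an edge (loops are allowed, and walks are counted with edge multiplicity if $G$ has multiple edges); its length is taken to be the number $k$ of vertices listed. To $w$ one associates $\gamma_w=t_{i_k}\cdots t_{i_2}t_{i_1}\in\Gamma$. $W_{N,i,j}$ is the set of all walks of length $N$ starting at $v_i$ and ending at $v_j$. Whenever $W_{N,i,j}\neq\emptyset$ (which holds for all large $N$), $P_{N,i,j}$ is the probability distribution on $\Gamma$ with density $p_{N,i,j}(\gamma)=|\{w\in W_{N,i,j}:\gamma_w=\gamma\}|/|W_{N,i,j}|$. *)

theory Defs
  imports
    "HOL-Library.Uprod"
    "HOL-Analysis.Nonnegative_Lebesgue_Integration"
    "HOL-Algebra.Generated_Groups"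
    "Jordan_Normal_Form.Schur_Decomposition"
begin

text \<open>
  The vertices of a graph with \<open>n\<close> vertices are numbered from \<open>0\<close> to \<open>n - 1\<close>. Edges are named
  objects, so that parallel edges are distinct; \<open>ends e\<close> is the unordered pair of end points
  of \<open>e\<close>, and \<open>e\<close> is a loop if it has the form \<open>Upair i i\<close>.
\<close>

record 'e multigraph =
  num_vertices :: nat
  edges :: "'e set"
  ends :: "'e \<Rightarrow> nat uprod"

definition finite_multigraph :: "'e multigraph \<Rightarrow> bool" where
  "finite_multigraph G \<longleftrightarrow>
     finite (edges G) \<and> (\<forall>e\<in>edges G. set_uprod (ends G e) \<subseteq> {..<num_vertices G})"

text \<open>A loop contributes one to its diagonal entry, in accordance with the counting of walks below.\<close>

definition adjacency_matrix :: "'e multigraph \<Rightarrow> real mat" where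
  "adjacency_matrix G =
     mat (num_vertices G) (num_vertices G) (\<lambda>(i, j). real (card {e \<in> edges G. ends G e = Upair i j}))"

text \<open>
  The exponent \<open>k\<close> has to be positive: the zeroth power of the one by one zero matrix is
  entrywise positive.
\<close>

definition perron_frobenius_matrix :: "real mat \<Rightarrow> bool" where
  "perron_frobenius_matrix A \<longleftrightarrow>
     (\<exists>!z. eigenvalue (map_mat complex_of_real A) z \<and>
           (\<forall>w. eigenvalue (map_mat complex_of_real A) w \<longrightarrow> cmod w \<le> cmod z)) \<and>
     (\<exists>k>0. \<forall>i<dim_row A. \<forall>j<dim_col A. (A ^\<^sub>m k) $$ (i, j) > 0)"

text \<open>
  A walk is given by its vertices together with the edges that are traversed, since walks are
  counted with the multiplicity of the edges. Its length \<open>N\<close> is the number of its vertices;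
  in particular there is no walk of length \<open>0\<close>.
\<close>

definition walks :: "'e multigraph \<Rightarrow> nat \<Rightarrow> nat \<Rightarrow> nat \<Rightarrow> (nat list \<times> 'e list) set" where
  "walks G N i j = {(vs, es).
     length vs = N \<and> length vs = Suc (length es) \<and>
     set vs \<subseteq> {..<num_vertices G} \<and> set es \<subseteq> edges G \<and>
     (\<forall>k<length es. ends G (es ! k) = Upair (vs ! k) (vs ! Suc k)) \<and>
     hd vs = i \<and> last vs = j}"

text \<open>Later vertices multiply from the left: \<open>[v\<^sub>1, \<dots>, v\<^sub>k]\<close> is sent to \<open>t v\<^sub>k \<otimes> \<dots> \<otimes> t v\<^sub>1\<close>.\<close>

definition walk_element ::
    "('g, 'm) monoid_scheme \<Rightarrow> (nat \<Rightarrow> 'g) \<Rightarrow> nat list \<times> 'e list \<Rightarrow> 'g" where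
  "walk_element \<Gamma> t w = foldl (\<lambda>g v. t v \<otimes>\<^bsub>\<Gamma>\<^esub> g) \<one>\<^bsub>\<Gamma>\<^esub> (fst w)"

definition walk_density ::
    "('g, 'm) monoid_scheme \<Rightarrow> 'e multigraph \<Rightarrow> (nat \<Rightarrow> 'g) \<Rightarrow> nat \<Rightarrow> nat \<Rightarrow> nat \<Rightarrow> 'g \<Rightarrow> real" where
  "walk_density \<Gamma> G t N i j \<gamma> =
     real (card {w \<in> walks G N i j. walk_element \<Gamma> t w = \<gamma>}) / real (card (walks G N i j))"

text \<open>Only meaningful if \<open>walks G N i j\<close> is not empty; otherwise this is the zero measure.\<close>

definition walk_distribution ::
    "('g, 'm) monoid_scheme \<Rightarrow> 'e multigraph \<Rightarrow> (nat \<Rightarrow> 'g) \<Rightarrow> nat \<Rightarrow> nat \<Rightarrow> nat \<Rightarrow> 'g measure" where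
  "walk_distribution \<Gamma> G t N i j =
     point_measure (carrier \<Gamma>) (\<lambda>\<gamma>. ennreal (walk_density \<Gamma> G t N i j \<gamma>))"

definition unitary_group :: "nat \<Rightarrow> complex mat monoid" where
  "unitary_group d =
     \<lparr>carrier = {U \<in> carrier_mat d d. U * mat_adjoint U = 1\<^sub>m d \<and> mat_adjoint U * U = 1\<^sub>m d},
      mult = (*), one = 1\<^sub>m d\<rparr>"

definition unitary_representation ::
    "('g, 'm) monoid_scheme \<Rightarrow> nat \<Rightarrow> ('g \<Rightarrow> complex mat) \<Rightarrow> bool" where
  "unitary_representation \<Gamma> d \<rho> \<longleftrightarrow> \<rho> \<in> hom \<Gamma> (unitary_group d)"

definition nontrivial_representation ::
    "('g, 'm) monoid_scheme \<Rightarrow> nat \<Rightarrow> ('g \<Rightarrow> complex mat) \<Rightarrow> bool" where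
  "nontrivial_representation \<Gamma> d \<rho> \<longleftrightarrow> (\<exists>x\<in>carrier \<Gamma>. \<rho> x \<noteq> 1\<^sub>m d)"

end

theory Submission
  imports Defs "HOL-Algebra.Multiplicative_Group" "HOL-Library.Real_Mod"
begin

text \<open>
  The letter \<open>A k l\<close> stands for the number of edges between the vertices \<open>k\<close> and \<open>l\<close>. The walks from
  \<open>i\<close> are the paths of a directed graph on pairs (vertex, group element), in which an edge from \<open>m\<close>
  to \<open>k\<close> leads from \<open>(m, x)\<close> to \<open>(k, t k \<otimes> x)\<close>. If some power of the adjacency matrix of this lifted
  graph is entrywise positive, then the walk forgets its starting point exponentially fast, in the
  manner of Doeblin. That positivity is the heart of the matter; the rest is a contraction estimate.

  \<^bold>\<open>Positivity.\<close> Fix \<open>i\<close> and let \<open>reach i r k\<close> be the set of products along walks from \<open>i\<close> to \<open>k\<close>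
  whose number of steps is congruent to \<open>r\<close> modulo the order of the group. Going back from \<open>k\<close> to
  \<open>i\<close> shows that each such set is a left coset of the subgroup \<open>H = reach i 0 i\<close>. An edge from \<open>m\<close> to
  \<open>k\<close> gives \<open>reach i (r + 1) k = t k \<otimes> reach i r m\<close>, hence all neighbours \<open>m\<close> of \<open>k\<close> have the same
  \<open>reach i r m\<close>. Since the graph is undirected and any two vertices are joined by a walk of even
  length, \<open>reach i r m\<close> does not depend on \<open>m\<close> at all: every decoration moves the coset of residue
  \<open>r\<close> to that of residue \<open>r + 1\<close> (\<open>reach_Suc\<close>). So a word in the decorations acts on these
  cosets only through its length. The condition on characters says that these lengths carry no
  periodicity: if all trivial words had length divisible by some \<open>d > 1\<close>, then sending a word of
  length \<open>L\<close> to \<open>exp (2 \<pi> \<i> L / d)\<close> would be a nontrivial character that is constant on the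
  decorations. Hence there are trivial words of consecutive lengths (\<open>consecutive_trivial_words\<close>), all
  the cosets are equal to \<open>H\<close>, the subgroup \<open>H\<close> contains every decoration, and \<open>H\<close> is the whole
  group (\<open>reach_all\<close>). Closed walks with trivial product then bring all walks to a common
  number of steps \<open>L\<close> (\<open>uniform_reach\<close>).

  \<^bold>\<open>Contraction.\<close> Let \<open>kernel N i k x\<close> be the weighted number of walks with \<open>N\<close> steps from \<open>i\<close> to
  \<open>k\<close> and product \<open>x\<close> (the decoration of \<open>i\<close> not included), and let \<open>total N i k\<close> be its sum over \<open>x\<close>.
  By positivity, every value \<open>kernel L l k x\<close> is at least a fixed fraction \<open>\<epsilon>\<close> of the mean of
  \<open>kernel L l k\<close> over the group. Splitting off this constant part, \<open>L\<close> more steps reduce the excess of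
  the largest relative frequency over \<open>1 / |\<Gamma>|\<close> by the factor \<open>1 - \<epsilon>\<close> (\<open>kernel_contraction\<close>). The
  excess is measured relative to \<open>total N i k\<close>, for each end point \<open>k\<close> separately, and the estimate
  survives the summation over the intermediate vertices because \<open>total\<close> obeys the product rule
  \<open>total_add\<close> for the concatenation of walks. Finally, frequencies that sum to one and are
  asymptotically at most \<open>1 / |\<Gamma>|\<close> must converge to \<open>1 / |\<Gamma>|\<close>.
\<close>

section \<open>Decorated graphs\<close>

text \<open>
  \<open>A\<close> is the matrix of edge multiplicities; its symmetry expresses that the graph is undirected.
\<close>

locale decorated_graph = group \<Gamma> for \<Gamma> :: "('g, 'm) monoid_scheme" (structure) +
  fixes n :: nat and A :: "nat \<Rightarrow> nat \<Rightarrow> real" and t :: "nat \<Rightarrow> 'g"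
  assumes finite_group: "finite (carrier \<Gamma>)"
    and t_closed [simp]: "k < n \<Longrightarrow> t k \<in> carrier \<Gamma>"
    and weight_nonneg [simp]: "0 \<le> A k l"
    and weight_sym: "A k l = A l k"
begin

lemma order_pos: "0 < Coset.order \<Gamma>"
  using finite_group by (simp add: order_gt_0_iff_finite)

lemma mult_inv_cancel_left:
  assumes "x \<in> carrier \<Gamma>" "y \<in> carrier \<Gamma>"
  shows "x \<otimes> (inv x \<otimes> y) = y" and "inv x \<otimes> (x \<otimes> y) = y"
  using assms by (simp_all flip: m_assoc)

section \<open>Lengths of words in the decorations\<close>

text \<open>
  These words are arbitrary products of decorations; their letters need not follow the edges.
\<close>

inductive word :: "nat \<Rightarrow> 'g \<Rightarrow> bool" where
  word_0: "word 0 \<one>"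
| word_Suc: "word L x \<Longrightarrow> k < n \<Longrightarrow> word (Suc L) (t k \<otimes> x)"

lemma word_closed: "word L x \<Longrightarrow> x \<in> carrier \<Gamma>"
  by (induction rule: word.induct) auto

lemma word_mult: "word L x \<Longrightarrow> word M y \<Longrightarrow> word (L + M) (x \<otimes> y)"
proof (induction rule: word.induct)
  case word_0
  then show ?case by (simp add: word_closed)
next
  case (word_Suc L x k)
  then show ?case using word.word_Suc[of "L + M" "x \<otimes> y" k] by (simp add: m_assoc word_closed)
qed

lemma word_letter: "k < n \<Longrightarrow> word 1 (t k)"
  using word_Suc[OF word_0, of k] by simp

lemma word_pow: "word L x \<Longrightarrow> word (p * L) (x [^] (p :: nat))"
proof (induction p)
  case 0
  then show ?case by (simp add: word_0)
next
  case (Suc p)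
  then show ?case using word_mult[of "p * L" "x [^] p" L x] by (simp add: add.commute)
qed

text \<open>
  In a finite group inverses are powers, hence sets closed under products are closed under inverses.
\<close>

lemma inv_eq_pow: "x \<in> carrier \<Gamma> \<Longrightarrow> inv x = x [^] (Coset.order \<Gamma> - 1)"
proof -
  assume x: "x \<in> carrier \<Gamma>"
  have "x [^] (Coset.order \<Gamma> - 1) \<otimes> x = x [^] (Suc (Coset.order \<Gamma> - 1))" by simp
  also have "\<dots> = \<one>" using order_pos x by (simp add: pow_order_eq_1 del: nat_pow_Suc)
  finally show ?thesis using x by (simp add: inv_equality)
qed

lemma word_exists:
  assumes "x \<in> generate \<Gamma> (t ` {..<n})"
  shows "\<exists>L. word L x"
  using assms
proof (induction rule: generate.induct)
  case one
  then show ?case using word_0 by blast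
next
  case (incl h)
  then show ?case using word_letter by auto
next
  case (inv h)
  then show ?case using word_pow[OF word_letter] inv_eq_pow t_closed by (metis imageE lessThan_iff)
next
  case (eng h1 h2)
  then show ?case using word_mult by blast
qed

text \<open>
  The differences of the lengths of trivial words form a subgroup \<open>d \<int>\<close> of the integers. Two words
  for the same element have lengths that agree modulo \<open>d\<close>, since both are completed to a trivial word by the same
  word for the inverse. Therefore \<open>exp (2 \<pi> \<i> L / d)\<close>, for a word of length \<open>L\<close>, is a well-defined
  character with the same value at all decorations, and the hypothesis forces \<open>d = 1\<close>.
\<close>

lemma consecutive_trivial_words:
  assumes "0 < n"
    and gen: "generate \<Gamma> (t ` {..<n}) = carrier \<Gamma>"
    and chars: "\<And>\<psi> :: 'g \<Rightarrow> complex.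
      \<lbrakk>\<And>x y. x \<in> carrier \<Gamma> \<Longrightarrow> y \<in> carrier \<Gamma> \<Longrightarrow> \<psi> (x \<otimes> y) = \<psi> x * \<psi> y;
       \<And>x. x \<in> carrier \<Gamma> \<Longrightarrow> cmod (\<psi> x) = 1;
       \<And>k l. k < n \<Longrightarrow> l < n \<Longrightarrow> \<psi> (t k) = \<psi> (t l)\<rbrakk>
      \<Longrightarrow> \<forall>x\<in>carrier \<Gamma>. \<psi> x = 1"
  shows "\<exists>a. word a \<one> \<and> word (Suc a) \<one>"
proof -
  define D where "D = {int a - int b |a b. word a \<one> \<and> word b \<one>}"
  have D_add: "x + y \<in> D" if "x \<in> D" "y \<in> D" for x y
  proof -
    obtain a b a' b' where *: "x = int a - int b" "y = int a' - int b'"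
      "word a \<one>" "word b \<one>" "word a' \<one>" "word b' \<one>"
      using \<open>x \<in> D\<close> \<open>y \<in> D\<close> by (auto simp: D_def)
    have "word (a + a') \<one>" "word (b + b') \<one>"
      using word_mult[of a \<one> a' \<one>] word_mult[of b \<one> b' \<one>] * by auto
    moreover have "x + y = int (a + a') - int (b + b')" using * by simp
    ultimately show ?thesis unfolding D_def by blast
  qed
  have D_I: "int a - int b \<in> D" if "word a \<one>" "word b \<one>" for a b
    using that unfolding D_def by blast
  have D_minus: "- x \<in> D" if "x \<in> D" for x
  proof -
    obtain a b where "x = int a - int b" "word a \<one>" "word b \<one>"
      using \<open>x \<in> D\<close> by (auto simp: D_def)
    thus ?thesis using D_I[of b a] by simp
  qed
  have D_0: "0 \<in> D" using D_I[OF word_0 word_0] by simp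
  have D_mult_nat: "int p * x \<in> D" if "x \<in> D" for p x
    by (induction p) (use D_0 D_add that in \<open>auto simp: algebra_simps\<close>)
  have D_mult: "q * x \<in> D" if "x \<in> D" for q x
    using D_mult_nat[OF that, of "nat q"] D_minus[OF D_mult_nat[OF that, of "nat (- q)"]]
    by (cases "0 \<le> q") auto
  have "word (Coset.order \<Gamma>) (t 0 [^] Coset.order \<Gamma>)"
    using word_pow[OF word_letter[OF \<open>0 < n\<close>], of "Coset.order \<Gamma>"] by simp
  hence "word (Coset.order \<Gamma>) \<one>" using \<open>0 < n\<close> by (simp add: pow_order_eq_1)
  hence "int (Coset.order \<Gamma>) \<in> D" using D_I[OF _ word_0] by fastforce
  hence ex: "\<exists>d>0. int d \<in> D" using order_pos by blast
  define d where "d = (LEAST d. 0 < d \<and> int d \<in> D)"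
  have d: "0 < d" "int d \<in> D" using LeastI_ex[OF ex] by (auto simp: d_def)
  have d_least: "\<not> (0 < m \<and> m < d \<and> int m \<in> D)" for m
    using not_less_Least[of m "\<lambda>d. 0 < d \<and> int d \<in> D"] by (auto simp: d_def)
  have d_dvd: "int d dvd x" if "x \<in> D" for x
  proof -
    have "x + - ((x div int d) * int d) = x mod int d"
      by (metis add_uminus_conv_diff minus_div_mult_eq_mod)
    hence "x mod int d \<in> D" using D_add[OF that D_minus[OF D_mult[OF d(2)]]] by metis
    hence "int (nat (x mod int d)) \<in> D" using d(1) by simp
    moreover have "nat (x mod int d) < d" using d(1) by (simp add: nat_less_iff)
    ultimately have "\<not> 0 < nat (x mod int d)" using d_least[of "nat (x mod int d)"] by simp
    moreover have "0 \<le> x mod int d" using d(1) by simp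
    ultimately have "x mod int d = 0" by simp
    thus ?thesis by (simp add: dvd_eq_mod_eq_0)
  qed
  define \<psi> :: "'g \<Rightarrow> complex" where "\<psi> x = cis (2 * pi * real (SOME L. word L x) / real d)" for x
  have \<psi>_word: "\<psi> x = cis (2 * pi * real L / real d)" if "word L x" for L x
  proof -
    define M where "M = (SOME L. word L x)"
    have M: "word M x" unfolding M_def by (rule someI) (rule that)
    have "inv x \<in> carrier \<Gamma>" using that word_closed by simp
    then obtain N where N: "word N (inv x)" using word_exists gen by auto
    have "word (M + N) \<one>" "word (L + N) \<one>"
      using word_mult[OF M N] word_mult[OF that N] word_closed[OF M] by auto
    hence "int (M + N) - int (L + N) \<in> D" by (rule D_I)
    then obtain q where "int (M + N) - int (L + N) = int d * q" using d_dvd by (metis dvdE)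
    hence "real_of_int (int M - int L) = real_of_int (int d * q)" by simp
    hence "real M = real L + real d * real_of_int q" by simp
    hence "2 * pi * real M / real d = 2 * pi * real L / real d + 2 * pi * real_of_int q"
      using d(1) by (simp add: field_simps)
    hence "cis (2 * pi * real M / real d) = cis (2 * pi * real L / real d) * cis (2 * pi * real_of_int q)"
      by (simp only: cis_mult)
    also have "cis (2 * pi * real_of_int q) = 1" by (rule cis_multiple_2pi) simp
    finally show ?thesis by (simp add: \<psi>_def M_def)
  qed
  have mult: "\<psi> (x \<otimes> y) = \<psi> x * \<psi> y" if xy: "x \<in> carrier \<Gamma>" "y \<in> carrier \<Gamma>" for x y
  proof -
    obtain L M where "word L x" "word M y" using word_exists[of x] word_exists[of y] gen xy by auto
    thus ?thesis
      using \<psi>_word[OF word_mult[of L x M y]] \<psi>_word[of L x] \<psi>_word[of M y]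
      by (simp add: cis_mult add_divide_distrib distrib_left)
  qed
  have letter: "\<psi> (t k) = cis (2 * pi / real d)" if "k < n" for k
    using \<psi>_word[OF word_letter[OF that]] by simp
  have "\<forall>x\<in>carrier \<Gamma>. \<psi> x = 1"
    by (rule chars) (auto simp: mult letter, simp add: \<psi>_def)
  hence "cis (2 * pi / real d) = 1" using letter[OF \<open>0 < n\<close>] \<open>0 < n\<close> by auto
  then obtain m :: int where "2 * pi / real d = of_int m * (2 * pi)" by (auto simp: cis_eq_1_iff)
  hence "real_of_int (m * int d) = 1" using d(1) by (simp add: field_simps)
  hence "m * int d = 1" by linarith
  hence "d = 1" by (simp add: zmult_eq_1_iff)
  then obtain a b where "word a \<one>" "word b \<one>" "int a - int b = 1" using d(2) by (auto simp: D_def)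
  moreover from this have "a = Suc b" by simp
  ultimately show ?thesis by blast
qed

end

section \<open>Products along walks\<close>

context decorated_graph
begin

text \<open>
  The decoration of the starting vertex is left out of the product, so that concatenation of walks corresponds to multiplication.
\<close>

inductive steps :: "nat \<Rightarrow> nat \<Rightarrow> nat \<Rightarrow> 'g \<Rightarrow> bool" where
  steps_0: "l < n \<Longrightarrow> steps 0 l l \<one>"
| steps_Suc: "steps L l m x \<Longrightarrow> k < n \<Longrightarrow> 0 < A m k \<Longrightarrow> steps (Suc L) l k (t k \<otimes> x)"

lemma steps_closed:
  assumes "steps L l k x"
  shows "l < n" and "k < n" and "x \<in> carrier \<Gamma>"
  using assms by (induction rule: steps.induct) auto

lemma steps_trans:
  "steps M m k y \<Longrightarrow> steps L l m x \<Longrightarrow> steps (L + M) l k (y \<otimes> x)"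
proof (induction rule: steps.induct)
  case (steps_0 m)
  then show ?case using steps_closed by fastforce
next
  case (steps_Suc M m m' y k)
  have "steps (Suc (L + M)) l k (t k \<otimes> (y \<otimes> x))"
    using steps.steps_Suc steps_Suc by blast
  then show ?case using steps_Suc by (simp add: m_assoc steps_closed)
qed

lemma steps_pow: "steps L k k x \<Longrightarrow> steps (p * L) k k (x [^] (p :: nat))"
proof (induction p)
  case 0
  then show ?case using steps_0 steps_closed by auto
next
  case (Suc p)
  then show ?case using steps_trans[of "p * L" k k "x [^] p" L k x] by simp
qed

text \<open>
  The number of steps is recorded modulo the order of the group because \<open>x [^] order \<Gamma> = \<one>\<close>: this makes
  the closed walks of residue \<open>0\<close> at a vertex a subgroup.
\<close>

definition reach :: "nat \<Rightarrow> nat \<Rightarrow> nat \<Rightarrow> 'g set" where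
  "reach i r k = {x. \<exists>L. steps L i k x \<and> L mod Coset.order \<Gamma> = r mod Coset.order \<Gamma>}"

lemma reach_closed: "x \<in> reach i r k \<Longrightarrow> x \<in> carrier \<Gamma>"
  by (auto simp: reach_def steps_closed)

lemma reach_cong: "r mod Coset.order \<Gamma> = s mod Coset.order \<Gamma> \<Longrightarrow> reach i r k = reach i s k"
  by (simp add: reach_def)

lemma one_in_reach: "i < n \<Longrightarrow> \<one> \<in> reach i 0 i"
  unfolding reach_def using steps_0 by blast

lemma reach_mult: "y \<in> reach m s k \<Longrightarrow> x \<in> reach i r m \<Longrightarrow> y \<otimes> x \<in> reach i (r + s) k"
  unfolding reach_def using steps_trans mod_add_cong by blast

lemma reach_pow: "x \<in> reach i 0 i \<Longrightarrow> x [^] (p :: nat) \<in> reach i 0 i"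
  unfolding reach_def using steps_pow by fastforce

end

section \<open>All group elements are reached\<close>

locale primitive_decorated_graph = decorated_graph +
  fixes q :: nat
  assumes q_pos: "0 < q"
    and connected: "k < n \<Longrightarrow> l < n \<Longrightarrow> \<exists>x. steps q k l x"
begin

lemma neighbour_exists: "k < n \<Longrightarrow> \<exists>m<n. 0 < A m k"
proof -
  assume "k < n"
  then obtain x where "steps q k k x" using connected by blast
  then show ?thesis using q_pos by cases (auto dest: steps_closed(2))
qed

lemma steps_exist: "q \<le> r \<Longrightarrow> k < n \<Longrightarrow> l < n \<Longrightarrow> \<exists>x. steps r k l x"
proof (induction r arbitrary: l rule: dec_induct)
  case base
  then show ?case using connected by blast
next
  case (step r)
  then show ?case using neighbour_exists[of l] steps_Suc by blast
qed

lemma reach_nonempty: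
  assumes "i < n" "k < n"
  obtains x where "x \<in> reach i r k"
proof -
  have "q \<le> r + q * Coset.order \<Gamma>" using order_pos by (simp add: trans_le_add2)
  then obtain x where "steps (r + q * Coset.order \<Gamma>) i k x" using steps_exist assms by blast
  then have "x \<in> reach i r k" unfolding reach_def by (auto intro!: exI)
  then show ?thesis by (rule that)
qed

text \<open>
  If \<open>z\<close> is the product along some walk from \<open>k\<close> back to \<open>i\<close> of complementary residue, then
  \<open>z \<otimes> x\<close> and \<open>z \<otimes> y\<close> both lie in the subgroup \<open>reach i 0 i\<close>, and
  \<open>y = x \<otimes> (inv (z \<otimes> x) \<otimes> (z \<otimes> y))\<close>.
\<close>

lemma reach_coset:
  assumes "i < n" "k < n" and x: "x \<in> reach i r k" and y: "y \<in> reach i r k"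
  shows "\<exists>h\<in>reach i 0 i. y = x \<otimes> h"
proof -
  define s where "s = (Coset.order \<Gamma> - 1) * r"
  have "r + s = Coset.order \<Gamma> * r"
    using order_pos by (cases "Coset.order \<Gamma>") (simp_all add: s_def)
  hence closing: "reach i (r + s) i = reach i 0 i" by (intro reach_cong) simp
  obtain z where z: "z \<in> reach k s i" using reach_nonempty assms by blast
  have zx: "z \<otimes> x \<in> reach i 0 i" and zy: "z \<otimes> y \<in> reach i 0 i"
    using reach_mult[OF z x] reach_mult[OF z y] closing by auto
  have cl: "x \<in> carrier \<Gamma>" "y \<in> carrier \<Gamma>" "z \<in> carrier \<Gamma>"
    using x y z reach_closed by auto
  have "inv (z \<otimes> x) \<in> reach i 0 i" using reach_pow[OF zx] inv_eq_pow cl by simp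
  hence "inv (z \<otimes> x) \<otimes> (z \<otimes> y) \<in> reach i 0 i" using reach_mult[OF _ zy] by fastforce
  moreover have "x \<otimes> (inv (z \<otimes> x) \<otimes> (z \<otimes> y)) = y"
    using cl by (simp add: inv_mult_group m_assoc mult_inv_cancel_left)
  ultimately show ?thesis by metis
qed

text \<open>
  Both sides are left cosets of the same subgroup, so the obvious inclusion is an equality.
\<close>

lemma reach_edge:
  assumes "i < n" "l < n" "k < n" "0 < A l k"
  shows "reach i (Suc r) k = (\<lambda>x. t k \<otimes> x) ` reach i r l"
proof
  show sub: "(\<lambda>x. t k \<otimes> x) ` reach i r l \<subseteq> reach i (Suc r) k"
  proof clarify
    fix x assume "x \<in> reach i r l"
    then obtain L where L: "steps L i l x" "L mod Coset.order \<Gamma> = r mod Coset.order \<Gamma>"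
      by (auto simp: reach_def)
    have "steps (Suc L) i k (t k \<otimes> x)" using steps_Suc L assms by blast
    moreover have "Suc L mod Coset.order \<Gamma> = Suc r mod Coset.order \<Gamma>"
      using L(2) by (metis mod_Suc_eq)
    ultimately show "t k \<otimes> x \<in> reach i (Suc r) k" by (auto simp: reach_def)
  qed
  show "reach i (Suc r) k \<subseteq> (\<lambda>x. t k \<otimes> x) ` reach i r l"
  proof
    fix y assume y: "y \<in> reach i (Suc r) k"
    obtain x where x: "x \<in> reach i r l" using reach_nonempty assms by blast
    then obtain h where h: "h \<in> reach i 0 i" "y = t k \<otimes> x \<otimes> h"
      using reach_coset[OF assms(1,3) _ y] sub by blast
    have "x \<otimes> h \<in> reach i r l" using reach_mult[OF x h(1)] by simp
    moreover have "y = t k \<otimes> (x \<otimes> h)"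
      using h x assms by (simp add: m_assoc reach_closed)
    ultimately show "y \<in> (\<lambda>x. t k \<otimes> x) ` reach i r l" by blast
  qed
qed

lemma reach_common_neighbour:
  assumes "i < n" "l < n" "m < n" "k < n" "0 < A l k" "0 < A m k"
  shows "reach i r l = reach i r m"
proof -
  have "(\<lambda>x. t k \<otimes> x) ` reach i r l = (\<lambda>x. t k \<otimes> x) ` reach i r m"
    using reach_edge[of i l k r] reach_edge[of i m k r] assms by simp
  moreover have "inj_on (\<lambda>x. t k \<otimes> x) (carrier \<Gamma>)"
    using assms by (simp add: inj_on_def)
  moreover have "reach i r l \<subseteq> carrier \<Gamma>" "reach i r m \<subseteq> carrier \<Gamma>"
    using reach_closed by auto
  ultimately show ?thesis by (simp add: inj_on_image_eq_iff)
qed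

text \<open>
  Two vertices at distance two have a common neighbour. The claim about odd walks is the
  intermediate state of an induction that advances one edge at a time.
\<close>

lemma reach_parity:
  assumes "steps L l k x" and "i < n"
  shows "(even L \<longrightarrow> reach i r l = reach i r k) \<and>
         (odd L \<longrightarrow> (\<forall>m<n. 0 < A m k \<longrightarrow> reach i r l = reach i r m))"
  using assms
proof (induction rule: steps.induct)
  case (steps_0 l)
  then show ?case by simp
next
  case (steps_Suc L l m x k)
  have m: "m < n" using steps_closed(2)[OF steps_Suc.hyps(1)] .
  have "0 < A k m" using steps_Suc.hyps(3) weight_sym[of k m] by simp
  hence odd_case: "odd L \<Longrightarrow> reach i r l = reach i r k"
    using steps_Suc.IH[OF steps_Suc.prems] steps_Suc.hyps(2) by blast
  have even_case: "reach i r l = reach i r m'" if "even L" "m' < n" "0 < A m' k" for m'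
    using steps_Suc.IH[OF steps_Suc.prems] \<open>even L\<close>
      reach_common_neighbour[OF steps_Suc.prems m that(2) steps_Suc.hyps(2,3) that(3)] by simp
  show ?case using odd_case even_case by simp
qed

text \<open>
  A walk with an even number of steps between any two vertices exists because \<open>2 * q\<close> steps suffice.
\<close>

lemma reach_indep:
  assumes "i < n" "l < n" "k < n"
  shows "reach i r l = reach i r k"
proof -
  obtain x where "steps (2 * q) l k x" using steps_exist[of "2 * q" l k] assms by auto
  then show ?thesis using reach_parity \<open>i < n\<close> by (metis dvd_triv_left)
qed

lemma reach_Suc:
  assumes "i < n" "k < n"
  shows "reach i (Suc r) i = (\<lambda>x. t k \<otimes> x) ` reach i r i"
proof -
  obtain m where "m < n" "0 < A m k" using neighbour_exists assms by blast
  then show ?thesis using reach_edge reach_indep assms by metis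
qed

lemma reach_word:
  assumes "word L w" "i < n"
  shows "reach i (r + L) i = (\<lambda>x. w \<otimes> x) ` reach i r i"
  using assms
proof (induction rule: word.induct)
  case word_0
  have "(\<lambda>x. \<one> \<otimes> x) ` reach i r i = (\<lambda>x. x) ` reach i r i"
    by (rule image_cong) (auto dest: reach_closed)
  then show ?case by simp
next
  case (word_Suc L w k)
  have "(\<lambda>x. t k \<otimes> x) ` ((\<lambda>x. w \<otimes> x) ` reach i r i) = (\<lambda>x. t k \<otimes> w \<otimes> x) ` reach i r i"
    unfolding image_image
    using word_Suc.hyps word_closed[OF word_Suc.hyps(1)] reach_closed
    by (intro image_cong refl) (simp add: m_assoc)
  then show ?case using word_Suc reach_Suc[of i k "r + L"] by simp
qed

lemma reach_trivial_word:
  assumes "word L \<one>" "i < n"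
  shows "reach i (r + L) i = reach i r i"
  using reach_word[OF assms] reach_word[OF word_0 assms(2), of r] by simp

text \<open>
  Trivial words of the lengths \<open>a\<close> and \<open>a + 1\<close> fix the cosets, so the coset of residue \<open>r\<close> is that
  of residue \<open>r + 1\<close>. All of them are then equal to the subgroup \<open>reach i 0 i\<close>, and a word \<open>x\<close> of
  length \<open>L\<close> is an element of \<open>x \<otimes> reach i 0 i = reach i L i = reach i 0 i\<close>.
\<close>

lemma reach_all:
  assumes "word a \<one>" "word (Suc a) \<one>"
    and gen: "generate \<Gamma> (t ` {..<n}) = carrier \<Gamma>"
    and ik: "i < n" "k < n" and x: "x \<in> carrier \<Gamma>"
  shows "x \<in> reach i 0 k"
proof -
  have Suc: "reach i (Suc r) i = reach i r i" for r
  proof -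
    \<comment> \<open>\<open>s\<close> represents \<open>r - a\<close> modulo the order of the group.\<close>
    define s where "s = r + (Coset.order \<Gamma> - 1) * a"
    have s: "s + a = r + Coset.order \<Gamma> * a"
      using order_pos by (cases "Coset.order \<Gamma>") (simp_all add: s_def)
    have "reach i (Suc r) i = reach i (s + Suc a) i"
      by (rule reach_cong) (use s in \<open>simp flip: add_Suc\<close>)
    also have "\<dots> = reach i (s + a) i"
      using reach_trivial_word[OF assms(1) ik(1), of s] reach_trivial_word[OF assms(2) ik(1), of s]
      by simp
    also have "\<dots> = reach i r i" by (rule reach_cong) (simp add: s)
    finally show ?thesis .
  qed
  have const: "reach i r i = reach i 0 i" for r
    by (induction r) (auto simp: Suc)
  obtain L where L: "word L x" using word_exists gen x by auto
  have "x \<otimes> \<one> \<in> reach i (0 + L) i"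
    using one_in_reach[OF ik(1)] reach_word[OF L ik(1), of 0] by auto
  then have "x \<in> reach i 0 i" using const[of L] x by simp
  then show ?thesis using reach_indep ik by blast
qed

text \<open>
  A walk with too few steps is prolonged by the power with exponent \<open>order \<Gamma>\<close> of a closed walk at
  its end: its product is trivial, and its number of steps may be any large multiple of \<open>order \<Gamma>\<close>.
\<close>

lemma uniform_reach:
  assumes "word a \<one>" "word (Suc a) \<one>"
    and gen: "generate \<Gamma> (t ` {..<n}) = carrier \<Gamma>"
  shows "\<exists>L>0. \<forall>i<n. \<forall>k<n. \<forall>x\<in>carrier \<Gamma>. steps L i k x"
proof -
  have "\<exists>c. steps (Coset.order \<Gamma> * c) i k x" if "i < n" "k < n" "x \<in> carrier \<Gamma>" for i k x
  proof -
    from reach_all[OF assms that] obtain M where M: "steps M i k x" "M mod Coset.order \<Gamma> = 0"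
      by (auto simp: reach_def)
    then show ?thesis by (metis mod_0_imp_dvd dvdE)
  qed
  then obtain c where c: "\<And>i k x. i < n \<Longrightarrow> k < n \<Longrightarrow> x \<in> carrier \<Gamma>
      \<Longrightarrow> steps (Coset.order \<Gamma> * c i k x) i k x"
    by metis
  define C where "C = (\<lambda>(i, k, x). c i k x) ` ({..<n} \<times> {..<n} \<times> carrier \<Gamma>)"
  define p where "p = Max C + q"
  have "steps (Coset.order \<Gamma> * p) i k x" if "i < n" "k < n" "x \<in> carrier \<Gamma>" for i k x
  proof -
    have "c i k x \<le> Max C"
      using that finite_group by (intro Max_ge) (force simp: C_def)+
    hence p: "q \<le> p - c i k x" "c i k x \<le> p" by (auto simp: p_def)
    obtain y where y: "steps (p - c i k x) k k y"
      using steps_exist[OF p(1) \<open>k < n\<close> \<open>k < n\<close>] by blast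
    have "steps (Coset.order \<Gamma> * (p - c i k x)) k k \<one>"
      using steps_pow[OF y, of "Coset.order \<Gamma>"] steps_closed[OF y] by (simp add: pow_order_eq_1)
    from steps_trans[OF this c[OF that]] show ?thesis
      using that p(2) by (simp flip: add_mult_distrib2)
  qed
  then show ?thesis using order_pos q_pos by (intro exI[of _ "Coset.order \<Gamma> * p"]) (simp add: p_def)
qed

end

section \<open>Walk counts and their contraction\<close>

context decorated_graph
begin

fun kernel :: "nat \<Rightarrow> nat \<Rightarrow> nat \<Rightarrow> 'g \<Rightarrow> real" where
  "kernel 0 i k x = (if i = k \<and> x = \<one> then 1 else 0)"
| "kernel (Suc N) i k x = (\<Sum>m<n. A m k * kernel N i m (inv (t k) \<otimes> x))"

definition total :: "nat \<Rightarrow> nat \<Rightarrow> nat \<Rightarrow> real" where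
  "total N i k = (\<Sum>x\<in>carrier \<Gamma>. kernel N i k x)"

lemma kernel_nonneg: "0 \<le> kernel N i k x"
  by (induction N arbitrary: k x) (auto intro: sum_nonneg)

lemma kernel_le_total: "x \<in> carrier \<Gamma> \<Longrightarrow> kernel N i k x \<le> total N i k"
  unfolding total_def using finite_group by (intro member_le_sum) (auto simp: kernel_nonneg)

lemma kernel_pos: "steps N i k x \<Longrightarrow> 0 < kernel N i k x"
proof (induction rule: steps.induct)
  case (steps_0 l)
  then show ?case by simp
next
  case (steps_Suc N i m x k)
  note cl = steps_closed[OF steps_Suc.hyps(1)]
  have "inv (t k) \<otimes> (t k \<otimes> x) = x"
    using cl steps_Suc.hyps(2) by (simp add: mult_inv_cancel_left)
  then have "0 < A m k * kernel N i m (inv (t k) \<otimes> (t k \<otimes> x))"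
    using steps_Suc by simp
  then show ?case
    unfolding kernel.simps using cl
    by (intro sum_pos2[of _ m]) (auto simp: kernel_nonneg)
qed

text \<open>
  The Chapman-Kolmogorov equation: a walk is cut after \<open>N\<close> steps, at the vertex \<open>l\<close> and with partial
  product \<open>y\<close>; later decorations stand on the left, so \<open>x \<otimes> inv y\<close> remains for the second part.
\<close>

lemma kernel_add:
  assumes "k < n" "x \<in> carrier \<Gamma>"
  shows "kernel (N + L) i k x = (\<Sum>l<n. \<Sum>y\<in>carrier \<Gamma>. kernel N i l y * kernel L l k (x \<otimes> inv y))"
  using assms
proof (induction L arbitrary: k x)
  case 0
  have "x \<otimes> inv y = \<one> \<longleftrightarrow> y = x" if "y \<in> carrier \<Gamma>" for y
    using 0 that by (metis inv_closed inv_equality inv_inv r_inv)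
  then have "kernel N i l y * kernel 0 l k (x \<otimes> inv y)
      = (if y = x then if l = k then kernel N i l x else 0 else 0)"
    if "y \<in> carrier \<Gamma>" for l y
    using that by auto
  then have "(\<Sum>l<n. \<Sum>y\<in>carrier \<Gamma>. kernel N i l y * kernel 0 l k (x \<otimes> inv y))
      = (\<Sum>l<n. if l = k then kernel N i l x else 0)"
    using 0 finite_group by (simp cong: sum.cong)
  then show ?case using 0 by simp
next
  case (Suc L)
  have "kernel (N + Suc L) i k x = (\<Sum>m<n. A m k * (\<Sum>l<n. \<Sum>y\<in>carrier \<Gamma>.
      kernel N i l y * kernel L l m (inv (t k) \<otimes> x \<otimes> inv y)))"
    using Suc by simp
  also have "\<dots> = (\<Sum>m<n. \<Sum>l<n. \<Sum>y\<in>carrier \<Gamma>.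
      kernel N i l y * (A m k * kernel L l m (inv (t k) \<otimes> (x \<otimes> inv y))))"
    using Suc.prems by (simp add: sum_distrib_left m_assoc mult.left_commute)
  also have "\<dots> = (\<Sum>l<n. \<Sum>m<n. \<Sum>y\<in>carrier \<Gamma>.
      kernel N i l y * (A m k * kernel L l m (inv (t k) \<otimes> (x \<otimes> inv y))))"
    by (rule sum.swap)
  also have "\<dots> = (\<Sum>l<n. \<Sum>y\<in>carrier \<Gamma>. \<Sum>m<n.
      kernel N i l y * (A m k * kernel L l m (inv (t k) \<otimes> (x \<otimes> inv y))))"
    by (intro sum.cong refl sum.swap)
  also have "\<dots> = (\<Sum>l<n. \<Sum>y\<in>carrier \<Gamma>. kernel N i l y * kernel (Suc L) l k (x \<otimes> inv y))"
    by (simp add: sum_distrib_left)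
  finally show ?case .
qed

lemma sum_kernel_translate_right:
  assumes "y \<in> carrier \<Gamma>"
  shows "(\<Sum>x\<in>carrier \<Gamma>. kernel L l k (x \<otimes> inv y)) = total L l k"
  unfolding total_def
  by (rule sum.reindex_bij_witness[of _ "\<lambda>z. z \<otimes> y" "\<lambda>x. x \<otimes> inv y"])
     (use assms in \<open>auto simp: m_assoc\<close>)

lemma sum_kernel_translate_inverse:
  assumes "x \<in> carrier \<Gamma>"
  shows "(\<Sum>y\<in>carrier \<Gamma>. kernel L l k (x \<otimes> inv y)) = total L l k"
  unfolding total_def
  by (rule sum.reindex_bij_witness[of _ "\<lambda>z. inv z \<otimes> x" "\<lambda>y. x \<otimes> inv y"])
     (use assms in \<open>auto simp: inv_mult_group m_assoc mult_inv_cancel_left\<close>)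

lemma total_add:
  assumes "k < n"
  shows "total (N + L) i k = (\<Sum>l<n. total N i l * total L l k)"
proof -
  have "total (N + L) i k
      = (\<Sum>x\<in>carrier \<Gamma>. \<Sum>l<n. \<Sum>y\<in>carrier \<Gamma>. kernel N i l y * kernel L l k (x \<otimes> inv y))"
    unfolding total_def using kernel_add assms by simp
  also have "\<dots> = (\<Sum>l<n. \<Sum>x\<in>carrier \<Gamma>. \<Sum>y\<in>carrier \<Gamma>. kernel N i l y * kernel L l k (x \<otimes> inv y))"
    by (rule sum.swap)
  also have "\<dots> = (\<Sum>l<n. \<Sum>y\<in>carrier \<Gamma>. \<Sum>x\<in>carrier \<Gamma>. kernel N i l y * kernel L l k (x \<otimes> inv y))"
    by (intro sum.cong refl sum.swap)
  also have "\<dots> = (\<Sum>l<n. \<Sum>y\<in>carrier \<Gamma>. kernel N i l y * total L l k)"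
    by (simp add: sum_distrib_left [symmetric] sum_kernel_translate_right)
  finally show ?thesis by (simp add: sum_distrib_right [symmetric] total_def)
qed

abbreviation "g \<equiv> real (Coset.order \<Gamma>)"

text \<open>
  By the lower bound \<open>minor\<close>, the kernel of \<open>L\<close> steps is the constant \<open>b = \<epsilon> * total L l k / g\<close> plus a
  nonnegative remainder. The constant contributes the uniform distribution, whatever the first \<open>N\<close>
  steps have done, and only the remainder, of total mass \<open>(1 - \<epsilon>) * total L l k\<close>, carries the excess
  \<open>c\<close> along.
\<close>

lemma kernel_contraction:
  assumes minor: "\<And>l k x. l < n \<Longrightarrow> k < n \<Longrightarrow> x \<in> carrier \<Gamma> \<Longrightarrow> \<epsilon> * total L l k \<le> g * kernel L l k x"
    and bound: "\<And>l y. l < n \<Longrightarrow> y \<in> carrier \<Gamma> \<Longrightarrow> kernel N i l y \<le> total N i l * (1 / g + c)"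
    and "k < n" and x: "x \<in> carrier \<Gamma>"
  shows "kernel (N + L) i k x \<le> total (N + L) i k * (1 / g + (1 - \<epsilon>) * c)"
proof -
  have g: "0 < g" using order_pos by simp
  have sum_const: "(\<Sum>y\<in>carrier \<Gamma>. r) = g * r" for r :: real
    by (simp add: Coset.order_def)
  have each: "(\<Sum>y\<in>carrier \<Gamma>. kernel N i l y * kernel L l k (x \<otimes> inv y))
      \<le> total N i l * total L l k * (1 / g + (1 - \<epsilon>) * c)" if l: "l < n" for l
  proof -
    define b where "b = \<epsilon> * total L l k / g"
    have "(\<Sum>y\<in>carrier \<Gamma>. kernel N i l y * (kernel L l k (x \<otimes> inv y) - b))
        \<le> (\<Sum>y\<in>carrier \<Gamma>. total N i l * (1 / g + c) * (kernel L l k (x \<otimes> inv y) - b))"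
    proof (rule sum_mono)
      fix y assume y: "y \<in> carrier \<Gamma>"
      have "0 \<le> kernel L l k (x \<otimes> inv y) - b"
        using minor[OF l \<open>k < n\<close>, of "x \<otimes> inv y"] x y g by (simp add: b_def field_simps)
      then show "kernel N i l y * (kernel L l k (x \<otimes> inv y) - b)
          \<le> total N i l * (1 / g + c) * (kernel L l k (x \<otimes> inv y) - b)"
        using bound[OF l y] by (rule mult_right_mono[rotated])
    qed
    also have "\<dots> = total N i l * (1 / g + c) * (total L l k - g * b)"
      by (simp only: sum_distrib_left [symmetric] sum_subtractf sum_kernel_translate_inverse[OF x] sum_const)
    finally have "(\<Sum>y\<in>carrier \<Gamma>. kernel N i l y * (kernel L l k (x \<otimes> inv y) - b))
        \<le> total N i l * (1 / g + c) * (total L l k - g * b)" .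
    moreover have "(\<Sum>y\<in>carrier \<Gamma>. kernel N i l y * (kernel L l k (x \<otimes> inv y) - b))
        = (\<Sum>y\<in>carrier \<Gamma>. kernel N i l y * kernel L l k (x \<otimes> inv y)) - total N i l * b"
      by (simp add: right_diff_distrib sum_subtractf total_def sum_distrib_right)
    ultimately have "(\<Sum>y\<in>carrier \<Gamma>. kernel N i l y * kernel L l k (x \<otimes> inv y))
        \<le> total N i l * (1 / g + c) * (total L l k - g * b) + total N i l * b" by simp
    also have "\<dots> = total N i l * total L l k * (1 / g + (1 - \<epsilon>) * c)"
      using g by (simp add: b_def field_simps)
    finally show ?thesis .
  qed
  have "kernel (N + L) i k x \<le> (\<Sum>l<n. total N i l * total L l k * (1 / g + (1 - \<epsilon>) * c))"
    unfolding kernel_add[OF \<open>k < n\<close> x] using each by (intro sum_mono) auto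
  also have "\<dots> = total (N + L) i k * (1 / g + (1 - \<epsilon>) * c)"
    by (simp add: total_add[OF \<open>k < n\<close>] sum_distrib_right)
  finally show ?thesis .
qed

text \<open>
  The initial excess is \<open>1 - 1 / g\<close> rather than \<open>1\<close>; being less than one, it permits a strict bound
  for every number of steps.
\<close>

lemma kernel_bound:
  assumes minor: "\<And>l k x. l < n \<Longrightarrow> k < n \<Longrightarrow> x \<in> carrier \<Gamma> \<Longrightarrow> \<epsilon> * total L l k \<le> g * kernel L l k x"
    and "k < n" "x \<in> carrier \<Gamma>"
  shows "kernel (r + p * L) i k x \<le> total (r + p * L) i k * (1 / g + (1 - \<epsilon>) ^ p * (1 - 1 / g))"
  using assms(2,3)
proof (induction p arbitrary: k x)
  case 0
  then show ?case using kernel_le_total by simp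
next
  case (Suc p)
  have "kernel (r + p * L + L) i k x
      \<le> total (r + p * L + L) i k * (1 / g + (1 - \<epsilon>) * ((1 - \<epsilon>) ^ p * (1 - 1 / g)))"
    by (rule kernel_contraction[OF minor Suc.IH Suc.prems])
  then show ?case by (simp add: ac_simps)
qed

lemma minorization_exists:
  assumes "\<And>l k x. l < n \<Longrightarrow> k < n \<Longrightarrow> x \<in> carrier \<Gamma> \<Longrightarrow> steps L l k x"
  obtains \<epsilon> :: real where "0 < \<epsilon>" "\<epsilon> \<le> 1"
    "\<And>l k x. l < n \<Longrightarrow> k < n \<Longrightarrow> x \<in> carrier \<Gamma> \<Longrightarrow> \<epsilon> * total L l k \<le> g * kernel L l k x"
proof -
  define R where "R = insert 1 ((\<lambda>(l, k, x). g * kernel L l k x / total L l k)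
    ` ({..<n} \<times> {..<n} \<times> carrier \<Gamma>))"
  have fin: "finite R" "R \<noteq> {}" using finite_group by (auto simp: R_def)
  have kpos: "0 < kernel L l k x" if "l < n" "k < n" "x \<in> carrier \<Gamma>" for l k x
    using kernel_pos assms that by blast
  have tpos: "0 < total L l k" if "l < n" "k < n" for l k
    using kpos[OF that, of \<one>] kernel_le_total[of \<one> L l k] by simp
  have "0 < r" if "r \<in> R" for r
    using that kpos tpos order_pos by (auto simp: R_def)
  then have "0 < Min R" using fin by simp
  moreover have "Min R \<le> 1" using fin by (simp add: R_def)
  moreover have "Min R * total L l k \<le> g * kernel L l k x"
    if "l < n" "k < n" "x \<in> carrier \<Gamma>" for l k x
  proof -
    have "Min R \<le> g * kernel L l k x / total L l k"
      using fin that by (intro Min_le) (force simp: R_def)+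
    then show ?thesis using tpos that by (simp add: pos_le_divide_eq)
  qed
  ultimately show ?thesis by (rule that)
qed

end

text \<open>
  Any \<open>\<eta> < 1\<close> above \<open>\<sigma>\<close> and \<open>\<theta>\<close> gives \<open>\<theta> ^ (N div L) * \<sigma> < \<eta> ^ (N div L + 1)\<close>, and
  \<open>N + 1 \<le> L * (N div L + 1)\<close>, so the \<open>L\<close>-th root of \<open>\<eta>\<close> is a suitable rate. Here the factor \<open>\<sigma> < 1\<close>
  pays for the incomplete last block of steps.
\<close>

lemma geometric_rate:
  fixes \<sigma> \<theta> :: real
  assumes "0 \<le> \<sigma>" "\<sigma> < 1" "0 \<le> \<theta>" "\<theta> < 1" "0 < L"
  shows "\<exists>c. 0 < c \<and> c < 1 \<and> (\<forall>N. \<theta> ^ (N div L) * \<sigma> < c ^ Suc N)"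
proof -
  obtain \<eta> where \<eta>: "max \<sigma> \<theta> < \<eta>" "\<eta> < 1" using dense[of "max \<sigma> \<theta>" 1] assms by auto
  have \<eta>0: "0 < \<eta>" using \<eta> assms by linarith
  define c where "c = root L \<eta>"
  have c: "0 < c" "c < 1" "c ^ L = \<eta>"
    using \<eta>0 \<eta> assms by (auto simp: c_def)
  have "\<theta> ^ (N div L) * \<sigma> < c ^ Suc N" for N
  proof -
    have "\<theta> ^ (N div L) * \<sigma> \<le> \<eta> ^ (N div L) * \<sigma>"
      using \<eta> assms by (intro mult_right_mono power_mono) auto
    also have "\<dots> < \<eta> ^ (N div L) * \<eta>"
      using \<eta> \<eta>0 by (intro mult_strict_left_mono) auto
    also have "\<dots> = c ^ (L * Suc (N div L))" by (simp only: power_mult c(3) power_Suc2)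
    also have "\<dots> \<le> c ^ Suc N"
      using c dividend_less_div_times[OF \<open>0 < L\<close>, of N]
      by (intro power_decreasing) (auto simp: algebra_simps)
    finally show ?thesis .
  qed
  with c show ?thesis by blast
qed

context primitive_decorated_graph
begin

lemma kernel_equidistribution:
  assumes "word a \<one>" "word (Suc a) \<one>"
    and "generate \<Gamma> (t ` {..<n}) = carrier \<Gamma>"
  shows "\<exists>c. 0 < c \<and> c < 1 \<and> (\<forall>N i k x. k < n \<longrightarrow> x \<in> carrier \<Gamma> \<longrightarrow> 0 < total N i k \<longrightarrow>
    kernel N i k x / total N i k - 1 / g < c ^ Suc N)"
proof -
  obtain L where L: "0 < L" "\<And>i k x. i < n \<Longrightarrow> k < n \<Longrightarrow> x \<in> carrier \<Gamma> \<Longrightarrow> steps L i k x"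
    using uniform_reach[OF assms] by blast
  obtain \<epsilon> :: real where \<epsilon>: "0 < \<epsilon>" "\<epsilon> \<le> 1"
    "\<And>l k x. l < n \<Longrightarrow> k < n \<Longrightarrow> x \<in> carrier \<Gamma> \<Longrightarrow> \<epsilon> * total L l k \<le> g * kernel L l k x"
    using minorization_exists[OF L(2)] by blast
  have "1 \<le> g" using order_pos by linarith
  then obtain c where c: "0 < c" "c < 1" "\<And>N. (1 - \<epsilon>) ^ (N div L) * (1 - 1 / g) < c ^ Suc N"
    using geometric_rate[of "1 - 1 / g" "1 - \<epsilon>" L] \<epsilon> L(1) by auto
  have "kernel N i k x / total N i k - 1 / g < c ^ Suc N"
    if "k < n" "x \<in> carrier \<Gamma>" "0 < total N i k" for N i k x
  proof -
    have "kernel N i k x \<le> total N i k * (1 / g + (1 - \<epsilon>) ^ (N div L) * (1 - 1 / g))"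
      using kernel_bound[OF \<epsilon>(3) that(1,2), where r = "N mod L" and p = "N div L" and i = i] by simp
    then have "kernel N i k x / total N i k \<le> 1 / g + (1 - \<epsilon>) ^ (N div L) * (1 - 1 / g)"
      using that(3) by (simp add: divide_le_eq mult.commute)
    then show ?thesis using c(3)[of N] by linarith
  qed
  with c show ?thesis by blast
qed

end

section \<open>Walks in multigraphs\<close>

lemma finite_walks: "finite_multigraph G \<Longrightarrow> finite (walks G N i j)"
  by (rule finite_subset[of _ "{vs. set vs \<subseteq> {..<num_vertices G} \<and> length vs = N} \<times>
        {es. set es \<subseteq> edges G \<and> length es = N - 1}"])
     (auto simp: walks_def finite_multigraph_def intro!: finite_cartesian_product finite_lists_length_eq)

lemma walks_1: "i < num_vertices G \<Longrightarrow> walks G (Suc 0) i j = (if i = j then {([i], [])} else {})"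
  by (auto simp: walks_def length_Suc_conv)

lemma walks_snoc:
  "(vs @ [v], es @ [e]) \<in> walks G (Suc (Suc N)) i k \<longleftrightarrow>
     v = k \<and> k < num_vertices G \<and> e \<in> edges G \<and> ends G e = Upair (last vs) k \<and>
     (vs, es) \<in> walks G (Suc N) i (last vs)"
proof (cases "length vs = Suc N \<and> length es = N")
  case True
  then have "vs \<noteq> []" by auto
  then have ends: "last vs = vs ! N" "hd (vs @ [v]) = hd vs"
    using True by (simp_all add: last_conv_nth)
  have "(\<forall>m<Suc N. ends G ((es @ [e]) ! m) = Upair ((vs @ [v]) ! m) ((vs @ [v]) ! Suc m)) \<longleftrightarrow>
      (\<forall>m<N. ends G (es ! m) = Upair (vs ! m) (vs ! Suc m)) \<and> ends G e = Upair (last vs) v"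
    using True ends by (auto simp: All_less_Suc nth_append simp del: Upair_inject)
  then show ?thesis
    using True ends(2) by (auto simp: walks_def simp del: Upair_inject)
qed (auto simp: walks_def)

lemma Upair_swap: "Upair k l = Upair l k"
  by simp

lemma walks_end: "(vs, es) \<in> walks G N i j \<Longrightarrow> last vs = j \<and> j < num_vertices G"
proof -
  assume w: "(vs, es) \<in> walks G N i j"
  then have "vs \<noteq> []" by (auto simp: walks_def)
  then have "last vs \<in> set vs" by simp
  then show ?thesis using w by (auto simp: walks_def)
qed

lemma walk_element_snoc: "walk_element \<Gamma> t (vs @ [v], es) = t v \<otimes>\<^bsub>\<Gamma>\<^esub> walk_element \<Gamma> t (vs, es')"
  by (simp add: walk_element_def)

context decorated_graph
begin

lemma walk_element_closed: "w \<in> walks G N i j \<Longrightarrow> num_vertices G = n \<Longrightarrow> walk_element \<Gamma> t w \<in> carrier \<Gamma>"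
proof -
  assume w: "w \<in> walks G N i j" "num_vertices G = n"
  have "set vs \<subseteq> {..<n} \<Longrightarrow> foldl (\<lambda>x v. t v \<otimes> x) \<one> vs \<in> carrier \<Gamma>" for vs
    by (induction vs rule: rev_induct) auto
  then show ?thesis using w by (auto simp: walks_def walk_element_def)
qed

text \<open>
  A walk with \<open>N\<close> steps has \<open>N + 1\<close> vertices, and its group element contains the decoration of
  the starting vertex as the rightmost factor. Removing the last vertex \<open>k\<close> and the last edge yields the
  recursion of the kernel.
\<close>

lemma card_walks_eq_kernel:
  assumes G: "finite_multigraph G" "num_vertices G = n"
    and A: "\<And>k l. A k l = real (card {e \<in> edges G. ends G e = Upair k l})"
    and "i < n" "k < n" "x \<in> carrier \<Gamma>"
  shows "real (card {w \<in> walks G (Suc N) i k. walk_element \<Gamma> t w = x \<otimes> t i}) = kernel N i k x"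
  using assms(5,6)
proof (induction N arbitrary: k x)
  case 0
  have "t i = x \<otimes> t i \<longleftrightarrow> x = \<one>" using 0 \<open>i < n\<close> by (metis r_cancel_one t_closed)
  then have "{w \<in> walks G (Suc 0) i k. walk_element \<Gamma> t w = x \<otimes> t i}
      = (if i = k \<and> x = \<one> then {([i], [])} else {})"
    using G(2) \<open>i < n\<close> by (auto simp: walks_1 walk_element_def)
  then show ?case by simp
next
  case (Suc N)
  define W where "W l = {w \<in> walks G (Suc N) i l. walk_element \<Gamma> t w = inv (t k) \<otimes> x \<otimes> t i}" for l
  define E where "E l = {e \<in> edges G. ends G e = Upair l k}" for l
  have element: "t k \<otimes> h = x \<otimes> t i \<longleftrightarrow> h = inv (t k) \<otimes> x \<otimes> t i" if "h \<in> carrier \<Gamma>" for h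
    using that Suc.prems \<open>i < n\<close> by (auto simp: m_assoc mult_inv_cancel_left inv_solve_left)
  have "bij_betw (\<lambda>(l, (vs, es), e). (vs @ [k], es @ [e])) (SIGMA l:{..<n}. W l \<times> E l)
      {w \<in> walks G (Suc (Suc N)) i k. walk_element \<Gamma> t w = x \<otimes> t i}" (is "bij_betw ?f ?S ?T")
  proof (rule bij_betwI')
    fix p p' assume p: "p \<in> ?S" "p' \<in> ?S"
    then show "(?f p = ?f p') = (p = p')"
      by (auto simp: W_def dest: walks_end)
  next
    fix p assume "p \<in> ?S"
    then obtain l vs es e where p: "p = (l, (vs, es), e)" "l < n" "(vs, es) \<in> W l" "e \<in> E l"
      by auto
    have walk: "(vs, es) \<in> walks G (Suc N) i l" using p by (simp add: W_def)
    then have "last vs = l" by (simp add: walks_end)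
    moreover have "t k \<otimes> walk_element \<Gamma> t (vs, es) = x \<otimes> t i"
      using p element walk_element_closed[OF walk G(2)] by (simp add: W_def)
    ultimately show "?f p \<in> ?T"
      using p walk Suc.prems G(2) walk_element_snoc[of \<Gamma> t vs k "es @ [e]" es]
      by (simp add: E_def walks_snoc)
  next
    fix w assume w: "w \<in> ?T"
    obtain us fs where us: "w = (us, fs)" by (cases w)
    have len: "length us = Suc (Suc N)" "length fs = Suc N" using w us by (auto simp: walks_def)
    obtain vs v where vs: "us = vs @ [v]" using len by (cases us rule: rev_cases) auto
    obtain es e where es: "fs = es @ [e]" using len by (cases fs rule: rev_cases) auto
    have s: "v = k" "e \<in> E (last vs)" "(vs, es) \<in> walks G (Suc N) i (last vs)"
      using w unfolding us vs es E_def by (auto simp: walks_snoc)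
    have "t k \<otimes> walk_element \<Gamma> t (vs, es) = x \<otimes> t i"
      using w s walk_element_snoc[of \<Gamma> t vs v fs es] unfolding us vs by simp
    then have "(vs, es) \<in> W (last vs)"
      using s element walk_element_closed[OF s(3) G(2)] by (simp add: W_def)
    then show "\<exists>p\<in>?S. w = ?f p"
      using s walks_end[OF s(3)] G(2) us vs es
      by (intro bexI[of _ "(last vs, (vs, es), e)"]) auto
  qed
  then have "card ?T = card ?S" by (simp add: bij_betw_same_card)
  also have "\<dots> = (\<Sum>l<n. card (W l) * card (E l))"
    using finite_walks[OF G(1)] G(1)
    by (subst card_SigmaI) (auto simp: W_def E_def finite_multigraph_def card_cartesian_product)
  finally have "real (card ?T) = (\<Sum>l<n. A l k * real (card (W l)))"
    by (simp add: A E_def mult.commute)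
  also have "\<dots> = kernel (Suc N) i k x"
    using Suc.IH[of _ "inv (t k) \<otimes> x"] Suc.prems by (simp add: W_def)
  finally show ?case .
qed

lemma sum_card_walks_by_element:
  assumes "finite_multigraph G" "num_vertices G = n"
  shows "(\<Sum>y\<in>carrier \<Gamma>. real (card {w \<in> walks G N i k. walk_element \<Gamma> t w = y}))
    = real (card (walks G N i k))"
  using sum.group[of "walks G N i k" "carrier \<Gamma>" "walk_element \<Gamma> t" "\<lambda>_. 1 :: real"]
    finite_walks[OF assms(1)] finite_group walk_element_closed[OF _ assms(2)] by fastforce

lemma card_walks_eq_total:
  assumes G: "finite_multigraph G" "num_vertices G = n"
    and A: "\<And>k l. A k l = real (card {e \<in> edges G. ends G e = Upair k l})"
    and "i < n" "k < n"
  shows "real (card (walks G (Suc N) i k)) = total N i k"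
proof -
  let ?W = "walks G (Suc N) i k"
  have "total N i k = (\<Sum>x\<in>carrier \<Gamma>. real (card {w \<in> ?W. walk_element \<Gamma> t w = x \<otimes> t i}))"
    unfolding total_def using card_walks_eq_kernel[OF assms] by simp
  also have "\<dots> = (\<Sum>y\<in>carrier \<Gamma>. real (card {w \<in> ?W. walk_element \<Gamma> t w = y}))"
    by (rule sum.reindex_bij_witness[of _ "\<lambda>y. y \<otimes> inv (t i)" "\<lambda>x. x \<otimes> t i"])
       (use \<open>i < n\<close> in \<open>auto simp: m_assoc\<close>)
  also have "\<dots> = real (card ?W)"
    by (rule sum_card_walks_by_element[OF G])
  finally show ?thesis by simp
qed

lemma walk_density_eq:
  assumes G: "finite_multigraph G" "num_vertices G = n"
    and A: "\<And>k l. A k l = real (card {e \<in> edges G. ends G e = Upair k l})"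
    and "i < n" "k < n" "y \<in> carrier \<Gamma>"
  shows "walk_density \<Gamma> G t (Suc N) i k y = kernel N i k (y \<otimes> inv (t i)) / total N i k"
proof -
  have "y \<otimes> inv (t i) \<otimes> t i = y" using assms by (simp add: m_assoc)
  then show ?thesis
    using card_walks_eq_kernel[OF assms(1-5), of "y \<otimes> inv (t i)" N]
      card_walks_eq_total[OF assms(1-5), of N] assms by (simp add: walk_density_def)
qed

lemma positive_power_imp_steps:
  assumes "0 < (mat n n (\<lambda>(k, l). A k l) ^\<^sub>m N) $$ (k, l)" "k < n" "l < n"
  shows "\<exists>x. steps N k l x"
  using assms
proof (induction N arbitrary: l)
  case 0
  then have "k = l" by (cases "k = l") auto
  then show ?case using 0 steps_0 by blast
next
  case (Suc N)
  let ?M = "mat n n (\<lambda>(k, l). A k l)"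
  have "(?M ^\<^sub>m Suc N) $$ (k, l) = (\<Sum>m<n. (?M ^\<^sub>m N) $$ (k, m) * A m l)"
    using Suc.prems by (simp add: scalar_prod_def atLeast0LessThan)
  then have "0 < (\<Sum>m<n. (?M ^\<^sub>m N) $$ (k, m) * A m l)" using Suc.prems by simp
  then obtain m where m: "m < n" "0 < (?M ^\<^sub>m N) $$ (k, m) * A m l"
    by (meson lessThan_iff not_less sum_nonpos)
  then have "0 < A m l" "0 < (?M ^\<^sub>m N) $$ (k, m)"
    using weight_nonneg[of m l] by (auto simp: zero_less_mult_iff)
  then show ?case using Suc.IH[of m] Suc.prems m steps_Suc by blast
qed

end

section \<open>Characters and limits\<close>

lemma unitary_representation_of_character:
  fixes \<psi> :: "'g \<Rightarrow> complex"
  assumes "\<And>x y. x \<in> carrier \<Gamma> \<Longrightarrow> y \<in> carrier \<Gamma> \<Longrightarrow> \<psi> (x \<otimes>\<^bsub>\<Gamma>\<^esub> y) = \<psi> x * \<psi> y"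
    and "\<And>x. x \<in> carrier \<Gamma> \<Longrightarrow> cmod (\<psi> x) = 1"
  shows "unitary_representation \<Gamma> 1 (\<lambda>x. mat 1 1 (\<lambda>_. \<psi> x))"
proof -
  have adj: "mat_adjoint (mat 1 1 (\<lambda>_. z)) = mat 1 1 (\<lambda>_. cnj z)" for z :: complex
    by (rule eq_matI) (auto simp: mat_adjoint_def mat_of_rows_def)
  have mult: "mat 1 1 (\<lambda>_. z) * mat 1 1 (\<lambda>_. w) = mat 1 1 (\<lambda>_. z * w)" for z w :: complex
    by (rule eq_matI) (auto simp: scalar_prod_def)
  have one: "mat 1 1 (\<lambda>_. 1 :: complex) = 1\<^sub>m 1"
    by (rule eq_matI) auto
  have norm: "\<psi> x * cnj (\<psi> x) = 1" if "x \<in> carrier \<Gamma>" for x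
    using assms(2)[OF that] by (simp add: complex_norm_square[symmetric])
  show ?thesis
    unfolding unitary_representation_def unitary_group_def hom_def
    using assms(1) norm
    by (auto simp del: One_nat_def simp: adj mult one mult.commute)
qed

text \<open>
  An upper bound suffices: what one value lacks must be made up by the excess of the
  \<open>card X - 1\<close> others.
\<close>

lemma one_sided_bound_tendsto:
  fixes p :: "nat \<Rightarrow> 'a \<Rightarrow> real"
  assumes "finite X" "x \<in> X" "0 < c" "c < 1"
    and total: "\<forall>\<^sub>F N in sequentially. (\<Sum>y\<in>X. p N y) = 1"
    and upper: "\<forall>\<^sub>F N in sequentially. \<forall>y\<in>X. p N y - 1 / real (card X) < c ^ N"
  shows "(\<lambda>N. p N x) \<longlonglongrightarrow> 1 / real (card X)"
proof (rule tendsto_sandwich)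
  have card: "0 < card X" using assms(1,2) card_gt_0_iff by blast
  have c: "(\<lambda>N. c ^ N) \<longlonglongrightarrow> 0" using assms(3,4) by (simp add: LIMSEQ_power_zero)
  show "\<forall>\<^sub>F N in sequentially. p N x \<le> 1 / real (card X) + c ^ N"
    using upper by eventually_elim (use \<open>x \<in> X\<close> in force)
  show "\<forall>\<^sub>F N in sequentially. 1 / real (card X) - real (card X - 1) * c ^ N \<le> p N x"
    using total upper
  proof eventually_elim
    case (elim N)
    have "(\<Sum>y\<in>X - {x}. p N y) \<le> (\<Sum>y\<in>X - {x}. 1 / real (card X) + c ^ N)"
      using elim(2) by (intro sum_mono) force
    also have "\<dots> = real (card X - 1) * (1 / real (card X) + c ^ N)"
      using assms(1,2) by simp
    also have "\<dots> = 1 - 1 / real (card X) + real (card X - 1) * c ^ N"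
      using card by (simp add: field_simps of_nat_diff)
    finally show ?case using elim(1) sum.remove[OF assms(1,2), of "p N"] by linarith
  qed
  show "(\<lambda>N. 1 / real (card X) + c ^ N) \<longlonglongrightarrow> 1 / real (card X)"
    using tendsto_add[OF tendsto_const c] by simp
  show "(\<lambda>N. 1 / real (card X) - real (card X - 1) * c ^ N) \<longlonglongrightarrow> 1 / real (card X)"
    using tendsto_diff[OF tendsto_const tendsto_mult[OF tendsto_const c]] by simp
qed

section \<open>Equidistribution along random walks\<close>

theorem theorem11p3:
  fixes \<Gamma> :: "('g, 'm) monoid_scheme" and G :: "'e multigraph"
    and t :: "nat \<Rightarrow> 'g" and i j :: nat
  assumes "group \<Gamma>" and "finite (carrier \<Gamma>)"
    and "finite_multigraph G"
    and "\<And>k. k < num_vertices G \<Longrightarrow> t k \<in> carrier \<Gamma>"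
    and "generate \<Gamma> (t ` {..<num_vertices G}) = carrier \<Gamma>"
    and "perron_frobenius_matrix (adjacency_matrix G)"
    and "\<And>\<rho>. unitary_representation \<Gamma> 1 \<rho> \<Longrightarrow> nontrivial_representation \<Gamma> 1 \<rho> \<Longrightarrow>
           \<exists>k<num_vertices G. \<exists>l<num_vertices G. \<rho> (t k) \<noteq> \<rho> (t l)"
    and "i < num_vertices G" and "j < num_vertices G"
  shows "(\<forall>A\<subseteq>carrier \<Gamma>. (\<lambda>N. measure (walk_distribution \<Gamma> G t N i j) A)
             \<longlonglongrightarrow> measure (uniform_count_measure (carrier \<Gamma>)) A) \<and>
         (\<exists>c::real. 0 < c \<and> c < 1 \<and>
           (\<forall>N\<ge>1. walks G N i j \<noteq> {} \<longrightarrow>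
             (\<forall>\<gamma>\<in>carrier \<Gamma>.
                walk_density \<Gamma> G t N i j \<gamma> - 1 / real (card (carrier \<Gamma>)) < c ^ N)))"
proof -
  define n where "n = num_vertices G"
  define w where "w k l = real (card {e \<in> edges G. ends G e = Upair k l})" for k l
  interpret group \<Gamma> by fact
  interpret decorated_graph \<Gamma> n w t
    by unfold_locales (use assms(2,4) in \<open>auto simp: n_def w_def Upair_swap\<close>)
  have adj: "adjacency_matrix G = mat n n (\<lambda>(k, l). w k l)"
    by (simp add: adjacency_matrix_def n_def w_def)
  obtain q where q: "0 < q" "\<And>k l. k < n \<Longrightarrow> l < n \<Longrightarrow> 0 < (adjacency_matrix G ^\<^sub>m q) $$ (k, l)"
    using assms(6) unfolding perron_frobenius_matrix_def adj by auto
  interpret primitive_decorated_graph \<Gamma> n w t q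
    by unfold_locales (use q positive_power_imp_steps in \<open>auto simp: adj\<close>)
  have gen: "generate \<Gamma> (t ` {..<n}) = carrier \<Gamma>" using assms(5) by (simp add: n_def)
  \<comment> \<open>The condition on representations, in terms of complex-valued characters\<close>
  have chars: "\<forall>x\<in>carrier \<Gamma>. \<psi> x = 1"
    if \<psi>: "\<And>x y. x \<in> carrier \<Gamma> \<Longrightarrow> y \<in> carrier \<Gamma> \<Longrightarrow> \<psi> (x \<otimes>\<^bsub>\<Gamma>\<^esub> y) = \<psi> x * \<psi> y"
      "\<And>x. x \<in> carrier \<Gamma> \<Longrightarrow> cmod (\<psi> x) = 1"
      "\<And>k l. k < n \<Longrightarrow> l < n \<Longrightarrow> \<psi> (t k) = \<psi> (t l)" for \<psi> :: "'g \<Rightarrow> complex"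
  proof -
    define \<rho> where "\<rho> x = mat 1 1 (\<lambda>_. \<psi> x)" for x
    have "unitary_representation \<Gamma> 1 \<rho>"
      unfolding \<rho>_def using \<psi>(1,2) by (rule unitary_representation_of_character)
    moreover have "\<rho> (t k) = \<rho> (t l)" if "k < n" "l < n" for k l
      using \<psi>(3)[OF that] by (simp add: \<rho>_def)
    ultimately have "\<not> nontrivial_representation \<Gamma> 1 \<rho>"
      using assms(7)[of \<rho>] by (auto simp: n_def)
    then have "\<rho> x $$ (0, 0) = 1\<^sub>m 1 $$ (0, 0)" if "x \<in> carrier \<Gamma>" for x
      using that by (simp add: nontrivial_representation_def)
    then show ?thesis by (simp add: \<rho>_def)
  qed
  have ij: "i < n" "j < n" using assms(8,9) by (auto simp: n_def)
  have "0 < n" using ij by simp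
  from this gen have "\<exists>a. word a \<one>\<^bsub>\<Gamma>\<^esub> \<and> word (Suc a) \<one>\<^bsub>\<Gamma>\<^esub>"
    by (rule consecutive_trivial_words) (rule chars)
  then obtain a where a: "word a \<one>\<^bsub>\<Gamma>\<^esub>" "word (Suc a) \<one>\<^bsub>\<Gamma>\<^esub>" by blast
  obtain c where c: "0 < c" "c < 1" "\<And>N i k x. k < n \<Longrightarrow> x \<in> carrier \<Gamma> \<Longrightarrow> 0 < total N i k \<Longrightarrow>
      kernel N i k x / total N i k - 1 / g < c ^ Suc N"
    using kernel_equidistribution[OF a gen] by metis
  note graph = assms(3) n_def[symmetric] w_def
  have rate: "walk_density \<Gamma> G t N i j y - 1 / real (card (carrier \<Gamma>)) < c ^ N"
    if N: "1 \<le> N" and ne: "walks G N i j \<noteq> {}" and y: "y \<in> carrier \<Gamma>" for N y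
  proof -
    obtain M where M: "N = Suc M" using N by (cases N) auto
    have "0 < card (walks G N i j)" using ne finite_walks[OF assms(3)] by (simp add: card_gt_0_iff)
    then have "0 < total M i j" using card_walks_eq_total[OF graph ij, of M] by (simp add: M)
    then show ?thesis
      using c(3)[OF ij(2), of "y \<otimes>\<^bsub>\<Gamma>\<^esub> inv\<^bsub>\<Gamma>\<^esub> (t i)" M i] walk_density_eq[OF graph ij y, of M] y ij
      by (simp add: M Coset.order_def)
  qed
  have walks_ne: "walks G N i j \<noteq> {}" if "Suc q \<le> N" for N
  proof -
    obtain M where M: "N = Suc M" "q \<le> M" using \<open>Suc q \<le> N\<close> by (cases N) auto
    obtain x where x: "steps M i j x" using steps_exist[OF M(2) ij] by blast
    then have "0 < total M i j"
      using kernel_pos kernel_le_total[of x M i j] steps_closed(3) by force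
    then show ?thesis using card_walks_eq_total[OF graph ij, of M] M by auto
  qed
  have density_sum: "(\<Sum>y\<in>carrier \<Gamma>. walk_density \<Gamma> G t N i j y) = 1" if "Suc q \<le> N" for N
  proof -
    let ?W = "walks G N i j"
    have "(\<Sum>y\<in>carrier \<Gamma>. real (card {v \<in> ?W. walk_element \<Gamma> t v = y})) = real (card ?W)"
      by (rule sum_card_walks_by_element[OF assms(3) n_def[symmetric]])
    moreover have "card ?W \<noteq> 0" using walks_ne[OF that] finite_walks[OF assms(3)] by simp
    ultimately show ?thesis
      by (simp add: walk_density_def sum_divide_distrib [symmetric])
  qed
  have conv: "(\<lambda>N. walk_density \<Gamma> G t N i j y) \<longlonglongrightarrow> 1 / real (card (carrier \<Gamma>))"
    if "y \<in> carrier \<Gamma>" for y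
  proof (rule one_sided_bound_tendsto[OF assms(2) that c(1,2)])
    show "\<forall>\<^sub>F N in sequentially. (\<Sum>y\<in>carrier \<Gamma>. walk_density \<Gamma> G t N i j y) = 1"
      by (rule eventually_sequentiallyI[of "Suc q"]) (rule density_sum)
    show "\<forall>\<^sub>F N in sequentially. \<forall>y\<in>carrier \<Gamma>.
        walk_density \<Gamma> G t N i j y - 1 / real (card (carrier \<Gamma>)) < c ^ N"
      by (rule eventually_sequentiallyI[of "Suc q"], intro ballI, rule rate)
        (simp_all add: walks_ne)
  qed
  have "(\<lambda>N. measure (walk_distribution \<Gamma> G t N i j) B)
      \<longlonglongrightarrow> measure (uniform_count_measure (carrier \<Gamma>)) B" if B: "B \<subseteq> carrier \<Gamma>" for B
  proof -
    have "measure (walk_distribution \<Gamma> G t N i j) B = (\<Sum>y\<in>B. walk_density \<Gamma> G t N i j y)" for N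
      unfolding walk_distribution_def measure_def
      using B assms(2) by (simp add: emeasure_point_measure_finite sum_ennreal walk_density_def sum_nonneg)
    moreover have "(\<lambda>N. \<Sum>y\<in>B. walk_density \<Gamma> G t N i j y) \<longlonglongrightarrow> (\<Sum>y\<in>B. 1 / real (card (carrier \<Gamma>)))"
      using B conv by (intro tendsto_sum) auto
    ultimately show ?thesis using B assms(2) by (simp add: measure_uniform_count_measure)
  qed
  then show ?thesis using c(1,2) rate by (intro conjI exI[of _ c] allI impI ballI) auto
qed

end
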